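(* Let $x,y\in\mathbb{C}\setminus\{0\}$ with $x,y\notin q^{\mathbb{Z}}$. Then $$l\widehat{\mu}(x,y)=iq^{-\frac18}\,\bigl(\mathcal{L}_q\circ\mathcal{B}_q\bigr)\bigl(\widetilde f_1\bigr)\Bigl(x,-\frac{x}{y}\Bigr),$$ where $\widetilde f_1$ is regarded as a formal power series in $x$ (with $y$ a parameter) and the $q$-Laplace transform is taken with $\lambda=-x/y$. Moreover $$l\widehat{\mu}(x,y)=\lim_{a\to0}(xy)^{-\frac{\alpha}{2}}a^{-\frac12}\,\widehat{\mu}(qx,y;a)=\lim_{a\to0}(xy)^{-\frac{\alpha}{2}}a^{-\frac12}\,\widehat{\mu}(x,qy;a),$$ where $a=q^{\alpha}$ with $\alpha\in\mathbb{C}$.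
   Context: Let $i=\sqrt{-1}$, $\tau\in\mathbb{C}$ with $\mathrm{Im}(\tau)>0$, $q=e^{2\pi i\tau}$, $q^{s}=e^{2\pi i\tau s}$ for $s\in\mathbb{C}$, $q^{\mathbb{Z}}=\{q^n:n\in\mathbb{Z}\}$, and $a=q^\alpha$ $(\alpha\in\mathbb{C})$. Set $(x)_\infty=\prod_{n\ge0}(1-xq^n)$, $(x)_n=(x)_\infty/(xq^n)_\infty$ for $n\in\mathbb{Z}$ (so $(0)_n=1$), $(a_1,\dots,a_r)_\beta=\prod_j(a_j)_\beta$ for $\beta\in\mathbb{Z}\cup\{\infty\}$, and $\theta(x)=(x,q/x)_\infty$. Series: ${}_r\phi_s\left(\begin{matrix}a_1,\dots,a_r\\ b_1,\dots,b_s\end{matrix};q;x\right)=\sum_{n\ge0}\frac{(a_1,\dots,a_r)_n}{(b_1,\dots,b_s,q)_n}\bigl((-1)^nq^{n(n-1)/2}\bigr)^{s-r+1}x^n$ and ${}_r\psi_s\left(\begin{matrix}a_1,\dots,a_r\\ b_1,\dots,b_s\end{matrix};q;x\right)=\sum_{n\in\mathbb{Z}}\frac{(a_1,\dots,a_r)_n}{(b_1,\dots,b_s)_n}\bigl((-1)^nq^{n(n-1)/2}\bigr)^{s-r}x^n$. The little $\mu$-function is, for $x,y\notin q^{\mathbb{Z}}$ nonzero, $$l\widehat{\mu}(x,y)=\frac{iq^{-1/8}}{(x,q)_\infty\theta(qy)}\,{}_1\psi_2\left(\begin{matrix}x\\0,0\end{matrix};q;\frac1y\right)=\frac{iq^{-1/8}}{(x,q)_\infty\theta(qy)}\sum_{n\in\mathbb{Z}}(x)_n(-1)^nq^{n(n-1)/2}y^{-n}.$$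 The generalized $\mu$-function is, for $x,y\notin q^{\mathbb{Z}}$ nonzero, $$\widehat{\mu}(x,y;a)=iq^{-1/8}\frac{(xy)^{\alpha/2}(ax)_\infty}{(x,q)_\infty\theta(y)}\,{}_1\psi_2\left(\begin{matrix}x\\0,ax\end{matrix};q;\frac qy\right),$$ where the product $(ax)_\infty\cdot\frac{1}{(ax)_n}$ is read as $(axq^n)_\infty$. Powers: fix a logarithm $L$ of $xy$ and set $(xy)^{s}=e^{sL}$, $(qxy)^s=q^s(xy)^s$, $a^{s}=q^{\alpha s}$. The formal series $\widetilde f_1(x)={}_2\phi_0\left(\begin{matrix}0,0\\-\end{matrix};q;xy\right)=\sum_{n\ge0}\frac{(-1)^nq^{-n(n-1)/2}}{(q)_n}(xy)^n$ is a divergent solution of $f(q^2x)-f(qx)-qxy\,f(x)=0$. For a formal series $g(x)=\sum_{n\ge0}a_nx^n$, the $q$-Borel transform is $\mathcal{B}_q(g)(\xi)=\sum_{n\ge0}a_nq^{n(n-1)/2}\xi^n$ (continued meromorphically to $\mathbb{C}$ where it converges near $0$), and the $q$-Laplace transform is $\mathcal{L}_q(g)(x;\lambda)=\sum_{n\in\mathbb{Z}}\frac{g(\lambda q^n)}{\theta_q(\lambda q^n/x)}$, where $\theta_q(z)=\sum_{n\in\mathbb{Z}}z^nq^{n(n-1)/2}=(q)_\infty\theta(-z)$. *)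

theory Defs
  imports "HOL-Complex_Analysis.Complex_Analysis"
begin

definition qpow :: "complex \<Rightarrow> complex \<Rightarrow> complex" where
  "qpow \<tau> s = exp (2 * of_real pi * \<i> * \<tau> * s)"

definition nome :: "complex \<Rightarrow> complex" where
  "nome \<tau> = exp (2 * of_real pi * \<i> * \<tau>)"

definition qZ :: "complex \<Rightarrow> complex set" where
  "qZ q = range (\<lambda>n::int. q powi n)"

definition qpoch_inf :: "complex \<Rightarrow> complex \<Rightarrow> complex" where
  "qpoch_inf q x = (\<Prod>n. 1 - x * q ^ n)"

definition qpoch :: "complex \<Rightarrow> complex \<Rightarrow> int \<Rightarrow> complex" where
  "qpoch q x n = qpoch_inf q x / qpoch_inf q (x * q powi n)"

definition qpochs :: "complex \<Rightarrow> complex list \<Rightarrow> int \<Rightarrow> complex" where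
  "qpochs q as n = (\<Prod>a\<leftarrow>as. qpoch q a n)"

definition theta :: "complex \<Rightarrow> complex \<Rightarrow> complex" where
  "theta q x = qpoch_inf q x * qpoch_inf q (q / x)"

text \<open>The integer division is exact, since \<open>n * (n - 1)\<close> is even.\<close>

definition qsign :: "complex \<Rightarrow> int \<Rightarrow> complex" where
  "qsign q n = (-1) powi n * q powi (n * (n - 1) div 2)"

text \<open>The unilateral series is kept formal, because it may diverge when there are
  more than \<open>s + 1\<close> upper parameters; the exponent \<open>s - r + 1\<close> is an integer.\<close>

definition phi_fps :: "complex \<Rightarrow> complex list \<Rightarrow> complex list \<Rightarrow> complex fps" where
  "phi_fps q as bs = Abs_fps (\<lambda>n. qpochs q as (int n) / qpochs q (bs @ [q]) (int n) *
     qsign q (int n) powi (int (length bs) - int (length as) + 1))"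

definition psi :: "complex \<Rightarrow> complex list \<Rightarrow> complex list \<Rightarrow> complex \<Rightarrow> complex" where
  "psi q as bs z = (\<Sum>\<^sub>\<infinity>n::int. qpochs q as n / qpochs q bs n *
     qsign q n powi (int (length bs) - int (length as)) * z powi n)"

definition little_mu :: "complex \<Rightarrow> complex \<Rightarrow> complex \<Rightarrow> complex" where
  "little_mu \<tau> x y = (let q = nome \<tau> in
     \<i> * qpow \<tau> (-1/8) / (qpoch_inf q x * qpoch_inf q q * theta q (q * y)) *
     psi q [x] [0, 0] (1 / y))"

text \<open>\<open>psi12_reg q x c z\<close> is \<open>(c)\<^sub>\<infinity>\<close> times the bilateral series with upper parameter \<open>x\<close> and
  lower parameters \<open>0, c\<close>, where \<open>(c)\<^sub>\<infinity> / (c)\<^sub>n\<close> is read as \<open>(c q\<^sup>n)\<^sub>\<infinity>\<close>, so that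
  it also makes sense when \<open>c\<close> is an integral power of \<open>q\<close>.\<close>

definition psi12_reg :: "complex \<Rightarrow> complex \<Rightarrow> complex \<Rightarrow> complex \<Rightarrow> complex" where
  "psi12_reg q x c z = (\<Sum>\<^sub>\<infinity>n::int. qpoch q x n / qpoch q 0 n * qpoch_inf q (c * q powi n) *
     qsign q n * z powi n)"

lemma psi12_reg_eq_psi:
  assumes "qpoch_inf q c \<noteq> 0"
  shows "psi12_reg q x c z = qpoch_inf q c * psi q [x] [0, c] z"
  using assms
  by (simp add: psi12_reg_def psi_def qpochs_def qpoch_def infsum_cmult_right' [symmetric]
      field_simps)

text \<open>\<open>L\<close> is the chosen logarithm of \<open>x * y\<close>; it determines \<open>(x y)\<^sup>s\<close> as \<open>exp (s * L)\<close>.\<close>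

definition mu_hat :: "complex \<Rightarrow> complex \<Rightarrow> complex \<Rightarrow> complex \<Rightarrow> complex \<Rightarrow> complex" where
  "mu_hat \<tau> L x y \<alpha> = (let q = nome \<tau>; a = qpow \<tau> \<alpha> in
     \<i> * qpow \<tau> (-1/8) * exp (\<alpha> / 2 * L) / (qpoch_inf q x * qpoch_inf q q * theta q y) *
     psi12_reg q x (a * x) (q / y))"

definition f1_fps :: "complex \<Rightarrow> complex \<Rightarrow> complex fps" where
  "f1_fps q y = phi_fps q [0, 0] [] oo (fps_const y * fps_X)"

definition qborel_fps :: "complex \<Rightarrow> complex fps \<Rightarrow> complex fps" where
  "qborel_fps q g = Abs_fps (\<lambda>n. fps_nth g n * q ^ (n * (n - 1) div 2))"

text \<open>Meromorphic continuation to the plane of the sum near \<open>0\<close>; the nicely meromorphic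
  representative (limits at removable points, \<open>0\<close> at poles) is unique.\<close>

definition qborel :: "complex \<Rightarrow> complex fps \<Rightarrow> complex \<Rightarrow> complex" where
  "qborel q g = (THE F. F nicely_meromorphic_on UNIV \<and> F has_fps_expansion qborel_fps q g)"

definition theta_q :: "complex \<Rightarrow> complex \<Rightarrow> complex" where
  "theta_q q z = (\<Sum>\<^sub>\<infinity>n::int. z powi n * q powi (n * (n - 1) div 2))"

definition qlaplace :: "complex \<Rightarrow> (complex \<Rightarrow> complex) \<Rightarrow> complex \<Rightarrow> complex \<Rightarrow> complex" where
  "qlaplace q g x l = (\<Sum>\<^sub>\<infinity>n::int. g (l * q powi n) / theta_q q (l * q powi n / x))"

text \<open>The limit \<open>a \<rightarrow> 0\<close> for functions of \<open>\<alpha>\<close>, where \<open>a = q\<^sup>\<alpha>\<close>.\<close>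

definition a_to_0 :: "complex \<Rightarrow> complex filter" where
  "a_to_0 \<tau> = filtercomap (qpow \<tau>) (at 0)"

end

theory Submission
  imports Defs
begin

text \<open>
  Write (as \<open>bilateral q w c z\<close> below) \<open>G(w, c; z) = \<Sum>\<^sub>n (-1)\<^sup>n q\<^bsup>n(n-1)/2\<^esup> z\<^sup>n (c q\<^sup>n)\<^sub>\<infinity> / (w q\<^sup>n)\<^sub>\<infinity>\<close>, the sum
  running over all integers. Cancelling \<open>(w)\<^sub>\<infinity>\<close> in the definitions shows that, up to elementary
  prefactors, \<open>l\<mu>(x, y)\<close> is \<open>G(x, 0; 1/y) / ((q)\<^sub>\<infinity> \<theta>(q y))\<close> and \<open>\<mu>(w, v; a)\<close> is
  \<open>G(w, a w; q/v) / ((q)\<^sub>\<infinity> \<theta>(v))\<close>. Everything is then a statement about \<open>G\<close>.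

  \<^item> Resummation. The Borel transform of the divergent series has coefficients \<open>(-y)\<^sup>n / (q)\<^sub>n\<close>, so
    by Euler's identity it is \<open>1 / (-y \<xi>)\<^sub>\<infinity>\<close>, meromorphic on the whole plane
    (\<open>qborel_f1\<close>). At \<open>\<xi> = - x q\<^sup>n / y\<close> this is \<open>1 / (x q\<^sup>n)\<^sub>\<infinity>\<close>, and quasi-periodicity turns
    \<open>1 / \<theta>\<^sub>q(- q\<^sup>n / y)\<close> into \<open>(-1)\<^sup>n q\<^bsup>n(n-1)/2\<^esup> y\<^bsup>-n\<^esup> / \<theta>\<^sub>q(- 1 / y)\<close>. So the Laplace
    transform is \<open>G(x, 0; 1/y) / \<theta>\<^sub>q(- 1 / y)\<close> term by term, and the prefactors agree by the Jacobi
    triple product \<open>\<theta>\<^sub>q(-z) = (q)\<^sub>\<infinity> \<theta>(z)\<close> (\<open>theta_q_eq_triple_product\<close>).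

  \<^item> Limits. The powers of \<open>x y\<close> and \<open>a\<close> in front of \<open>\<mu>\<close> cancel exactly, since \<open>\<mu>\<close> is taken
    at arguments whose product is \<open>q x y\<close>; what remains depends on \<open>\<alpha>\<close> only through \<open>a\<close>. As
    \<open>a \<rightarrow> 0\<close> it tends to the same expression with \<open>c = 0\<close> by dominated convergence
    (\<open>tendsto_bilateral\<close>). For the arguments \<open>(x, q y)\<close> that is literally the little \<open>\<mu>\<close>-function;
    for \<open>(q x, y)\<close> shifting the summation index by one produces a factor \<open>- y\<close>, which
    \<open>\<theta>(y) = - y \<theta>(q y)\<close> absorbs.

  The domination works because \<open>(c q\<^sup>n)\<^sub>\<infinity> / (w q\<^sup>n)\<^sub>\<infinity>\<close> grows at most geometrically in \<open>n\<close>, in both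
  directions and uniformly in \<open>c\<close> of modulus at most 1, while \<open>q\<^bsup>n(n-1)/2\<^esup>\<close> decays like a Gaussian.
\<close>

section \<open>The infinite \<open>q\<close>-Pochhammer symbol\<close>

lemma convergent_prod_qpoch:
  fixes q x :: complex
  assumes "norm q < 1"
  shows "convergent_prod (\<lambda>n. 1 - x * q ^ n)"
proof -
  have "summable (\<lambda>n. norm x * norm q ^ n)"
    using assms by (intro summable_mult summable_geometric) auto
  hence "abs_convergent_prod (\<lambda>n. 1 - x * q ^ n)"
    by (intro summable_imp_abs_convergent_prod) (simp add: norm_mult norm_power)
  thus ?thesis
    by (rule abs_convergent_prod_imp_convergent_prod)
qed

lemma LIMSEQ_qpoch_inf:
  assumes "norm q < 1"
  shows "(\<lambda>n. \<Prod>k<n. 1 - x * q ^ k) \<longlonglongrightarrow> qpoch_inf q x"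
  using convergent_prod_LIMSEQ[OF convergent_prod_qpoch[OF assms, of x]]
  by (simp add: qpoch_inf_def LIMSEQ_lessThan_iff_atMost)

lemma qpoch_inf_eq_0_iff:
  assumes "norm q < 1"
  shows "qpoch_inf q x = 0 \<longleftrightarrow> (\<exists>n. x * q ^ n = 1)"
proof -
  have "(\<lambda>n. 1 - x * q ^ n) has_prod qpoch_inf q x"
    unfolding qpoch_inf_def using convergent_prod_qpoch[OF assms] by blast
  from has_prod_eq_0_iff[OF this] show ?thesis
    by (force simp: image_iff)
qed

lemma qpoch_inf_0 [simp]: "qpoch_inf q 0 = 1"
  by (simp add: qpoch_inf_def)

lemma qpoch_inf_rec:
  assumes "norm q < 1"
  shows "qpoch_inf q x = (1 - x) * qpoch_inf q (x * q)"
proof (rule LIMSEQ_unique)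
  \<comment> \<open>Comparing limits of partial products also covers a vanishing factor.\<close>
  show "(\<lambda>n. \<Prod>k<Suc n. 1 - x * q ^ k) \<longlonglongrightarrow> qpoch_inf q x"
    using LIMSEQ_qpoch_inf[OF assms] by (rule LIMSEQ_Suc)
  have "(\<Prod>k<Suc n. 1 - x * q ^ k) = (1 - x) * (\<Prod>k<n. 1 - (x * q) * q ^ k)" for n
    by (subst prod.lessThan_Suc_shift) (simp add: mult.assoc)
  moreover have "(\<lambda>n. (1 - x) * (\<Prod>k<n. 1 - (x * q) * q ^ k)) \<longlonglongrightarrow> (1 - x) * qpoch_inf q (x * q)"
    by (intro tendsto_intros LIMSEQ_qpoch_inf assms)
  ultimately show "(\<lambda>n. \<Prod>k<Suc n. 1 - x * q ^ k) \<longlonglongrightarrow> (1 - x) * qpoch_inf q (x * q)"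
    by simp
qed

lemma norm_qpoch_inf_le:
  assumes "norm q < 1"
  shows "norm (qpoch_inf q x) \<le> exp (norm x / (1 - norm q))"
proof (rule LIMSEQ_le_const2)
  show "(\<lambda>n. norm (\<Prod>k<n. 1 - x * q ^ k)) \<longlonglongrightarrow> norm (qpoch_inf q x)"
    by (intro tendsto_norm LIMSEQ_qpoch_inf assms)
  have "norm (\<Prod>k<n. 1 - x * q ^ k) \<le> exp (norm x / (1 - norm q))" for n
  proof -
    have "norm (\<Prod>k<n. 1 - x * q ^ k) = (\<Prod>k<n. norm (1 - x * q ^ k))"
      by (simp add: prod_norm)
    also have "\<dots> \<le> (\<Prod>k<n. exp (norm x * norm q ^ k))"
    proof (intro prod_mono conjI)
      fix k
      have "norm (1 - x * q ^ k) \<le> 1 + norm x * norm q ^ k"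
        by (metis norm_mult norm_one norm_power norm_triangle_ineq4)
      also have "\<dots> \<le> exp (norm x * norm q ^ k)"
        by (rule exp_ge_add_one_self)
      finally show "norm (1 - x * q ^ k) \<le> exp (norm x * norm q ^ k)" .
    qed auto
    also have "\<dots> = exp (norm x * (\<Sum>k<n. norm q ^ k))"
      by (simp add: exp_sum sum_distrib_left)
    also have "(\<Sum>k<n. norm q ^ k) \<le> (\<Sum>k. norm q ^ k)"
      using assms by (intro sum_le_suminf summable_geometric) auto
    also have "(\<Sum>k. norm q ^ k) = 1 / (1 - norm q)"
      using assms by (intro suminf_geometric) auto
    finally show ?thesis
      by (simp add: mult_left_mono)
  qed
  thus "\<exists>N. \<forall>n\<ge>N. norm (\<Prod>k<n. 1 - x * q ^ k) \<le> exp (norm x / (1 - norm q))"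
    by blast
qed

lemma qpoch_inf_nonzero:
  assumes "norm q < 1" "q \<noteq> 0" "w \<notin> qZ q"
  shows "qpoch_inf q (w * q powi n) \<noteq> 0"
proof
  assume "qpoch_inf q (w * q powi n) = 0"
  then obtain k where "w * q powi n * q ^ k = 1"
    using qpoch_inf_eq_0_iff[OF assms(1)] by auto
  hence "w * q powi (n + int k) = 1"
    using assms(2) by (simp add: power_int_add mult_ac)
  hence "w = q powi (- (n + int k))"
    unfolding power_int_minus by (metis inverse_unique mult.commute)
  with assms(3) show False by (auto simp: qZ_def)
qed

lemma holomorphic_qpoch_inf:
  assumes "norm q < 1"
  shows "qpoch_inf q holomorphic_on UNIV"
proof (rule holomorphic_uniform_sequence)
  show "(\<lambda>x. \<Prod>k<n. 1 - x * q ^ k) holomorphic_on UNIV" for n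
    by (intro holomorphic_intros)
  fix x :: complex
  have "uniformly_convergent_on (cball x 1) (\<lambda>N z. \<Sum>n<N. norm (1 - z * q ^ n - 1))"
  proof (rule Weierstrass_m_test')
    fix n z assume "z \<in> cball x 1"
    hence "norm z \<le> norm x + 1"
      by (metis add.commute add_le_cancel_left diff_add_cancel dist_commute dist_norm mem_cball
          norm_triangle_le order_refl order_trans)
    thus "norm (norm (1 - z * q ^ n - 1)) \<le> (norm x + 1) * norm q ^ n"
      by (simp add: norm_mult norm_power mult_right_mono)
  next
    show "summable (\<lambda>n. (norm x + 1) * norm q ^ n)"
      using assms by (intro summable_mult summable_geometric) auto
  qed
  hence "uniformly_convergent_on (cball x 1) (\<lambda>N z. \<Prod>n<N. 1 - z * q ^ n)"
    by (intro uniformly_convergent_on_prod') (auto intro!: continuous_intros)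
  then obtain g where g: "uniform_limit (cball x 1) (\<lambda>N z. \<Prod>n<N. 1 - z * q ^ n) g sequentially"
    by (auto simp: uniformly_convergent_on_def)
  have "g z = qpoch_inf q z" if "z \<in> cball x 1" for z
    using tendsto_uniform_limitI[OF g that] LIMSEQ_qpoch_inf[OF assms] LIMSEQ_unique by blast
  hence "uniform_limit (cball x 1) (\<lambda>N z. \<Prod>n<N. 1 - z * q ^ n) (qpoch_inf q) sequentially"
    using g by (metis (mono_tags, lifting) uniform_limit_cong')
  thus "\<exists>d>0. cball x d \<subseteq> UNIV \<and>
           uniform_limit (cball x d) (\<lambda>N z. \<Prod>n<N. 1 - z * q ^ n) (qpoch_inf q) sequentially"
    by (intro exI[of _ 1]) auto
qed auto

section \<open>Bilateral sums with Gaussian decay\<close>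

text \<open>
  Tannery's theorem for sums over an arbitrary index set: the domination makes the
  finite partial sums converge uniformly in the parameter, so the two limits may be exchanged.
\<close>

lemma tendsto_infsum_dominated:
  fixes f :: "'a \<Rightarrow> 'b \<Rightarrow> 'c :: banach"
  assumes lim: "\<And>k. ((\<lambda>n. f k n) \<longlongrightarrow> g k) F"
    and bound: "eventually (\<lambda>n. \<forall>k. norm (f k n) \<le> M k) F"
    and M: "M summable_on UNIV" and [simp]: "F \<noteq> bot"
  shows "((\<lambda>n. \<Sum>\<^sub>\<infinity>k. f k n) \<longlongrightarrow> (\<Sum>\<^sub>\<infinity>k. g k)) F"
proof -
  have g: "norm (g k) \<le> M k" for k
  proof (rule tendsto_upperbound)
    show "((\<lambda>n. norm (f k n)) \<longlongrightarrow> norm (g k)) F"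
      by (intro tendsto_norm lim)
  qed (use bound in \<open>auto elim: eventually_mono\<close>)
  have "g summable_on UNIV"
    using Infinite_Sum.abs_summable_on_comparison_test'[OF M g] abs_summable_summable by blast
  show ?thesis
  proof (rule swap_uniform_limit')
    show "\<forall>\<^sub>F K in finite_subsets_at_top UNIV. ((\<lambda>n. \<Sum>k\<in>K. f k n) \<longlongrightarrow> (\<Sum>k\<in>K. g k)) F"
      by (intro always_eventually allI tendsto_intros lim)
    show "((\<lambda>K. \<Sum>k\<in>K. g k) \<longlongrightarrow> (\<Sum>\<^sub>\<infinity>k. g k)) (finite_subsets_at_top UNIV)"
      using \<open>g summable_on UNIV\<close> by (rule infsum_tendsto)
    show "uniform_limit {n. \<forall>k. norm (f k n) \<le> M k} (\<lambda>K n. \<Sum>k\<in>K. f k n) (\<lambda>n. \<Sum>\<^sub>\<infinity>k. f k n)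
            (finite_subsets_at_top UNIV)"
      by (rule Weierstrass_m_test_general[OF _ M]) auto
    show "\<forall>\<^sub>F n in F. n \<in> {n. \<forall>k. norm (f k n) \<le> M k}"
      using bound by simp
  qed auto
qed

text \<open>
  The triangular number \<open>n (n - 1) / 2\<close> on all integers. All exponent bookkeeping rests on the
  quadratic law \<open>tri_add\<close>.
\<close>

definition tri :: "int \<Rightarrow> int" where
  "tri n = n * (n - 1) div 2"

lemma two_tri: "2 * tri n = n * (n - 1)"
  by (simp add: tri_def)

lemma tri_add: "tri (m + n) = tri m + tri n + m * n"
  using two_tri[of m] two_tri[of n] two_tri[of "m + n"] by (simp add: algebra_simps)

lemma tri_int: "tri (int n) = int (n * (n - 1) div 2)"
  by (cases n) (auto simp: tri_def zdiv_int algebra_simps)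

lemma tri_minus_int: "tri (- int n) = int (n * (n - 1) div 2) + int n"
  unfolding tri_int[symmetric] using two_tri[of "- int n"] two_tri[of "int n"]
  by (simp add: algebra_simps)

lemma qsign_altdef: "qsign q n = (-1) powi n * q powi tri n"
  by (simp add: qsign_def tri_def)

lemma norm_qsign: "norm (qsign q n) = norm q powi tri n"
  by (simp add: qsign_altdef norm_mult norm_power_int)

lemma qsign_add:
  assumes "q \<noteq> 0"
  shows "qsign q (m + n) = qsign q m * qsign q n * q powi (m * n)"
  using assms by (simp add: qsign_altdef tri_add power_int_add)

lemma summable_nat_gaussian:
  fixes r z :: real
  assumes "0 < r" "r < 1" "z > 0"
  shows "summable (\<lambda>n. z ^ n * r ^ (n * (n - 1) div 2))"
proof -
  have "(\<lambda>n. z * r ^ n) \<longlonglongrightarrow> z * 0"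
    using assms by (intro tendsto_intros LIMSEQ_realpow_zero) auto
  hence "eventually (\<lambda>n. z * r ^ n < 1/2) sequentially"
    by (intro order_tendstoD) auto
  then obtain N where N: "\<And>n. n \<ge> N \<Longrightarrow> z * r ^ n < 1/2"
    by (auto simp: eventually_sequentially)
  show ?thesis
  proof (rule summable_ratio_test)
    fix n assume "n \<ge> N"
    have "Suc n * (Suc n - 1) div 2 = n * (n - 1) div 2 + n"
      by (cases n) (auto simp: algebra_simps)
    hence "norm (z ^ Suc n * r ^ (Suc n * (Suc n - 1) div 2)) =
            (z * r ^ n) * norm (z ^ n * r ^ (n * (n - 1) div 2))"
      using assms by (simp add: power_add abs_mult)
    also have "\<dots> \<le> 1 / 2 * norm (z ^ n * r ^ (n * (n - 1) div 2))"
      using N[OF \<open>n \<ge> N\<close>] by (intro mult_right_mono) auto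
    finally show "norm (z ^ Suc n * r ^ (Suc n * (Suc n - 1) div 2)) \<le>
            1 / 2 * norm (z ^ n * r ^ (n * (n - 1) div 2))" .
  qed auto
qed

text \<open>
  The negative half of the sum is the positive half with \<open>z\<close> replaced by \<open>r / z\<close>, because
  \<open>tri (- n) = tri n + n\<close>.
\<close>

lemma summable_gaussian:
  fixes r z :: real
  assumes "0 < r" "r < 1" "z > 0"
  shows "(\<lambda>n::int. z powi n * r powi tri n) summable_on UNIV"
proof -
  let ?f = "\<lambda>n::int. z powi n * r powi tri n"
  have UNIV_eq: "(UNIV :: int set) = range int \<union> range (\<lambda>n. - int n)"
    by (auto simp: image_iff) (metis int_cases2)
  have "?f summable_on range int"
  proof (subst summable_on_reindex)
    show "?f \<circ> int summable_on UNIV"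
      using summable_nat_gaussian[OF assms] assms
      by (intro summable_nonneg_imp_summable_on) (simp_all add: o_def tri_int)
  qed auto
  moreover have "?f summable_on range (\<lambda>n. - int n)"
  proof (subst summable_on_reindex)
    have "?f (- int n) = (r / z) ^ n * r ^ (n * (n - 1) div 2)" for n
      using assms by (simp add: tri_minus_int power_int_add power_int_minus power_divide field_simps)
    thus "?f \<circ> (\<lambda>n. - int n) summable_on UNIV"
      using summable_nat_gaussian[of r "r / z"] assms
      by (intro summable_nonneg_imp_summable_on) (simp_all add: o_def)
  qed (auto simp: inj_on_def)
  ultimately show ?thesis
    unfolding UNIV_eq by (rule summable_on_union)
qed

section \<open>The Jacobi triple product and the theta functions\<close>

lemma nome_power_neq_1:
  fixes q :: complex
  assumes "norm q < 1"
  shows "q ^ Suc k \<noteq> 1"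
proof
  assume "q ^ Suc k = 1"
  hence "1 = norm q * norm q ^ k"
    by (metis norm_mult norm_one norm_power power_Suc)
  also have "\<dots> \<le> norm q * 1"
    using assms by (intro mult_left_mono power_le_one) auto
  finally show False using assms by simp
qed

text \<open>
  The finite \<open>q\<close>-binomial theorem (Rothe's identity). Multiplying by the factor \<open>1 - z q\<^sup>m\<close> acts on the
  coefficients by the \<open>q\<close>-Pascal rule \<open>c (m+1) (k+1) = c m (k+1) + q\<^bsup>m-k\<^esup> c m k\<close>.
\<close>

lemma q_binomial:
  fixes q z :: complex
  assumes "norm q < 1" "q \<noteq> 0"
  defines "P \<equiv> \<lambda>m. \<Prod>k<m. 1 - q ^ Suc k"
  shows "(\<Prod>k<m. 1 - z * q ^ k) =
           (\<Sum>k\<le>m. qsign q (int k) * z ^ k * (P m / (P k * P (m - k))))"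
proof (induction m)
  case 0
  show ?case by (simp add: P_def qsign_altdef tri_def)
next
  case (Suc m)
  have nz: "1 - q ^ Suc k \<noteq> 0" for k
    using nome_power_neq_1[OF assms(1), of k] by simp
  have Pnz [simp]: "P k \<noteq> 0" for k
    unfolding P_def using nz by simp
  have P0: "P 0 = 1"
    by (simp add: P_def)
  have P_Suc: "P (Suc k) = P k * (1 - q ^ Suc k)" for k
    by (simp add: P_def)
  \<comment> \<open>Setting the Gaussian binomials to zero for \<open>k > m\<close> lets Pascal's rule hold up to \<open>k = m\<close>.\<close>
  define c where "c m k = (if k \<le> m then P m / (P k * P (m - k)) else 0)" for m k
  have c_Suc: "c (Suc m) (Suc k) = c m (Suc k) + q ^ (m - k) * c m k" if "k \<le> m" for k
  proof (cases "k = m")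
    case True
    thus ?thesis by (simp add: c_def P0)
  next
    case False
    define d where "d = m - Suc k"
    have m: "m = k + Suc d"
      using False that by (simp add: d_def)
    show ?thesis
      using nz[of k] nz[of d] unfolding m c_def
      by (simp add: P_Suc divide_simps Suc_diff_le del: power_Suc)
         (simp add: algebra_simps power_add)
  qed
  have q0: "q ^ k * qsign q (int k) = - qsign q (int (Suc k))" for k
    using qsign_add[OF assms(2), of "int k" 1]
    by (simp add: qsign_altdef tri_def mult.commute add.commute)
  have "(\<Prod>k<Suc m. 1 - z * q ^ k) = (\<Prod>k<m. 1 - z * q ^ k) - z * q ^ m * (\<Prod>k<m. 1 - z * q ^ k)"
    by (simp add: algebra_simps)
  also have "(\<Prod>k<m. 1 - z * q ^ k) = (\<Sum>k\<le>m. qsign q (int k) * z ^ k * c m k)"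
    unfolding Suc.IH by (intro sum.cong) (auto simp: c_def)
  also have "(\<Sum>k\<le>m. qsign q (int k) * z ^ k * c m k)
       - z * q ^ m * (\<Sum>k\<le>m. qsign q (int k) * z ^ k * c m k)
     = (\<Sum>k\<le>Suc m. qsign q (int k) * z ^ k * c m k)
       + (\<Sum>k\<le>m. qsign q (int (Suc k)) * z ^ Suc k * (q ^ (m - k) * c m k))"
  proof -
    have "z * q ^ m * (qsign q (int k) * z ^ k * c m k) =
          - (qsign q (int (Suc k)) * z ^ Suc k * (q ^ (m - k) * c m k))" if "k \<le> m" for k
    proof -
      have qm: "q ^ m = q ^ (m - k) * q ^ k"
        using that by (simp flip: power_add)
      have "z * q ^ m * (qsign q (int k) * z ^ k * c m k) =
            (q ^ k * qsign q (int k)) * (z ^ Suc k * (q ^ (m - k) * c m k))"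
        unfolding qm by (simp add: mult_ac)
      thus ?thesis unfolding q0 by (simp add: mult_ac)
    qed
    hence "z * q ^ m * (\<Sum>k\<le>m. qsign q (int k) * z ^ k * c m k) =
       - (\<Sum>k\<le>m. qsign q (int (Suc k)) * z ^ Suc k * (q ^ (m - k) * c m k))"
      by (simp add: sum_distrib_left sum_negf[symmetric] del: power_Suc of_nat_Suc)
    thus ?thesis by (simp add: c_def)
  qed
  also have "\<dots> = c m 0 + (\<Sum>k\<le>m. qsign q (int (Suc k)) * z ^ Suc k * (c m (Suc k) + q ^ (m - k) * c m k))"
    by (subst sum.atMost_Suc_shift)
       (simp add: sum.distrib ring_distribs qsign_altdef tri_def del: power_Suc of_nat_Suc)
  also have "\<dots> = c (Suc m) 0 + (\<Sum>k\<le>m. qsign q (int (Suc k)) * z ^ Suc k * c (Suc m) (Suc k))"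
    by (intro arg_cong2[of _ _ _ _ "(+)"] sum.cong)
       (auto simp: c_Suc c_def[of _ 0] P0 simp del: power_Suc of_nat_Suc)
  also have "\<dots> = (\<Sum>k\<le>Suc m. qsign q (int k) * z ^ k * c (Suc m) k)"
    by (subst sum.atMost_Suc_shift) (simp add: qsign_altdef tri_def del: power_Suc of_nat_Suc)
  finally show ?case
    by (simp add: c_def del: power_Suc of_nat_Suc cong: sum.cong_simp)
qed

text \<open>
  Put \<open>2 n\<close> for \<open>m\<close> and \<open>z q\<^bsup>-n\<^esup>\<close> for \<open>z\<close> in the \<open>q\<close>-binomial theorem. The upper half of the product is
  then \<open>(z)\<^sub>n\<close>; reversing the lower half gives \<open>(q/z)\<^sub>n\<close> times a monomial, which is exactly what
  centring the summation range at \<open>0\<close> cancels.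
\<close>

lemma finite_triple_product:
  fixes q z :: complex
  assumes "norm q < 1" "q \<noteq> 0" "z \<noteq> 0"
  defines "P \<equiv> \<lambda>m. \<Prod>k<m. 1 - q ^ Suc k"
  shows "(\<Prod>k<n. 1 - z * q ^ k) * (\<Prod>k<n. 1 - q / z * q ^ k) =
           (\<Sum>j\<in>{- int n..int n}. qsign q j * z powi j *
             (P (2 * n) / (P (nat (int n + j)) * P (nat (int n - j)))))"
proof -
  define w where "w = z * q powi (- int n)"
  have prod_split: "(\<Prod>k<2 * n. 1 - w * q ^ k) =
      (\<Prod>k<n. 1 - w * q ^ k) * (\<Prod>k<n. 1 - z * q ^ k)"
  proof -
    have "(\<Prod>k<n + m. 1 - w * q ^ k) = (\<Prod>k<n. 1 - w * q ^ k) * (\<Prod>k<m. 1 - z * q ^ k)" for m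
      using assms(2) by (induction m) (simp_all add: w_def power_int_minus power_add field_simps)
    thus ?thesis by (simp add: mult_2)
  qed
  \<comment> \<open>Factor \<open>k\<close> of the lower half is a monomial times factor \<open>n - 1 - k\<close> of \<open>(q/z)\<^sub>n\<close>.\<close>
  have rev: "qsign q (int n) * w ^ n * (\<Prod>k<n. 1 - q / z * q ^ k) = (\<Prod>k<n. 1 - w * q ^ k)"
  proof -
    have eq: "(\<Prod>k<n. 1 - w * q ^ k) = (\<Prod>k<n. (- (w * q ^ k)) * (1 - q / z * q ^ (n - Suc k)))"
    proof (intro prod.cong refl)
      fix k assume "k \<in> {..<n}"
      hence "q ^ n = q * q ^ k * q ^ (n - Suc k)"
        by (simp flip: power_Suc power_add)
      hence "w * q ^ k * (q / z * q ^ (n - Suc k)) = 1"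
        using assms(2,3) by (simp add: w_def power_int_minus field_simps)
      thus "1 - w * q ^ k = (- (w * q ^ k)) * (1 - q / z * q ^ (n - Suc k))"
        by (simp add: ring_distribs)
    qed
    have "qsign q (int n) * w ^ n = (\<Prod>k<n. - (w * q ^ k))"
    proof (induction n)
      case 0
      show ?case by (simp add: qsign_altdef tri_def)
    next
      case (Suc n)
      have "qsign q (int (Suc n)) = - (qsign q (int n) * q ^ n)"
        using qsign_add[OF assms(2), of "int n" 1]
        by (simp add: qsign_altdef[of _ 1] tri_def add.commute)
      with Suc show ?case by (simp add: mult_ac flip: Suc.IH)
    qed
    moreover have "(\<Prod>k<n. 1 - q / z * q ^ (n - Suc k)) = (\<Prod>k<n. 1 - q / z * q ^ k)"
      by (rule prod.nat_diff_reindex)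
    ultimately show ?thesis
      unfolding eq by (simp only: prod.distrib)
  qed
  have wz: "w \<noteq> 0" "qsign q (int n) \<noteq> 0"
    using assms(2,3) by (auto simp: w_def qsign_altdef)
  have "qsign q (int n) * w ^ n * ((\<Prod>k<n. 1 - z * q ^ k) * (\<Prod>k<n. 1 - q / z * q ^ k)) =
        (\<Prod>k<2 * n. 1 - w * q ^ k)"
    unfolding prod_split rev[symmetric] by (simp add: mult_ac)
  also have "\<dots> = (\<Sum>k\<le>2 * n. qsign q (int k) * w ^ k * (P (2 * n) / (P k * P (2 * n - k))))"
    unfolding P_def by (rule q_binomial[OF assms(1,2)])
  also have "\<dots> = (\<Sum>j\<in>{- int n..int n}. qsign q (j + int n) * w powi (j + int n) *
             (P (2 * n) / (P (nat (int n + j)) * P (nat (int n - j)))))"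
    by (rule sum.reindex_bij_witness[of _ "\<lambda>j. nat (j + int n)" "\<lambda>k. int k - int n"])
       (auto simp: nat_diff_distrib power_int_def divide_inverse
         intro!: arg_cong2[of _ _ _ _ "(*)"] arg_cong[of _ _ P] arg_cong[of _ _ inverse])
  also have "\<dots> = qsign q (int n) * w ^ n * (\<Sum>j\<in>{- int n..int n}. qsign q j * z powi j *
             (P (2 * n) / (P (nat (int n + j)) * P (nat (int n - j)))))"
    unfolding sum_distrib_left
  proof (intro sum.cong refl)
    fix j
    have "qsign q (j + int n) * w powi (j + int n) =
          qsign q (int n) * w ^ n * (qsign q j * (q powi (j * int n) * w powi j))"
      using assms(2) wz by (simp add: qsign_add power_int_add)
    also have "q powi (j * int n) * w powi j = z powi j"
    proof -
      have "w powi j = z powi j * q powi (- int n * j)"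
        unfolding w_def power_int_mult_distrib power_int_mult ..
      moreover have "q powi (j * int n) * q powi (- int n * j) = 1"
        using assms(2) by (simp add: mult.commute flip: power_int_add)
      ultimately show ?thesis by simp
    qed
    finally show "qsign q (j + int n) * w powi (j + int n) *
             (P (2 * n) / (P (nat (int n + j)) * P (nat (int n - j)))) =
          qsign q (int n) * w ^ n * (qsign q j * z powi j *
             (P (2 * n) / (P (nat (int n + j)) * P (nat (int n - j)))))"
      by (simp add: mult_ac)
  qed
  finally show ?thesis
    using wz by simp
qed

lemma nonzero_convergent_bounded_below:
  fixes f :: "nat \<Rightarrow> 'a :: real_normed_field"
  assumes "f \<longlonglongrightarrow> L" "L \<noteq> 0" "\<And>n. f n \<noteq> 0"
  obtains d where "d > 0" "\<And>n. d \<le> norm (f n)"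
proof -
  have "Bseq (\<lambda>n. inverse (f n))"
    using tendsto_inverse[OF assms(1,2)] by (intro convergent_imp_Bseq convergentI)
  then obtain K where K: "K > 0" "\<And>n. norm (inverse (f n)) \<le> K"
    by (auto elim: BseqE)
  show ?thesis
  proof (rule that[of "1 / K"])
    show "1 / K \<le> norm (f n)" for n
      using K(2)[of n] K(1) assms(3)[of n] by (auto simp: norm_inverse norm_divide field_simps)
  qed (use K in auto)
qed

text \<open>
  Let \<open>n\<close> tend to infinity in the finite identity. Each coefficient tends to \<open>1 / (q)\<^sub>\<infinity>\<close>; the
  coefficients are uniformly bounded since the finite products \<open>(q)\<^sub>m\<close> are bounded and bounded away
  from zero, so the terms are dominated by a Gaussian.
\<close>

lemma theta_q_eq_triple_product:
  assumes q: "norm q < 1" "q \<noteq> 0" and z: "z \<noteq> 0"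
  shows "theta_q q (- z) = qpoch_inf q q * theta q z"
proof -
  define P where "P = (\<lambda>m. \<Prod>k<m. 1 - q ^ Suc k)"
  have P_nz: "P m \<noteq> 0" for m
    using nome_power_neq_1[OF q(1)] by (auto simp: P_def simp del: power_Suc)
  have P_lim: "P \<longlonglongrightarrow> qpoch_inf q q"
    using LIMSEQ_qpoch_inf[OF q(1), of q] by (simp add: P_def)
  have qq_nz: "qpoch_inf q q \<noteq> 0"
    using nome_power_neq_1[OF q(1)] by (auto simp: qpoch_inf_eq_0_iff[OF q(1)])
  obtain d where d: "d > 0" "\<And>n. d \<le> norm (P n)"
    using nonzero_convergent_bounded_below[OF P_lim qq_nz P_nz] by blast
  obtain K where K: "K > 0" "\<And>n. norm (P n) \<le> K"
    using convergent_imp_Bseq[OF convergentI[OF P_lim]] by (auto elim: BseqE)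
  \<comment> \<open>Padding with zeros turns the finite sums into sums over one fixed index set.\<close>
  define f where "f j n = (if j \<in> {- int n..int n} then qsign q j * z powi j *
      (P (2 * n) / (P (nat (int n + j)) * P (nat (int n - j)))) else 0)" for j n
  have "(\<lambda>n. \<Sum>\<^sub>\<infinity>j. f j n) \<longlonglongrightarrow>
         (\<Sum>\<^sub>\<infinity>j. qsign q j * z powi j * (qpoch_inf q q / (qpoch_inf q q * qpoch_inf q q)))"
  proof (rule tendsto_infsum_dominated)
    fix j :: int
    have lim_shift: "filterlim (\<lambda>n. nat (int n + i)) at_top sequentially" for i
      unfolding filterlim_at_top
    proof
      fix Z
      show "eventually (\<lambda>n. Z \<le> nat (int n + i)) sequentially"
        using eventually_ge_at_top[of "nat (int Z - i)"] by eventually_elim auto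
    qed
    have P1: "(\<lambda>n. P (nat (int n + i))) \<longlonglongrightarrow> qpoch_inf q q" for i
      using filterlim_compose[OF P_lim lim_shift] .
    have P2: "(\<lambda>n. P (2 * n)) \<longlonglongrightarrow> qpoch_inf q q"
      by (rule filterlim_compose[OF P_lim]) (auto intro!: filterlim_subseq strict_monoI)
    have "(\<lambda>n. qsign q j * z powi j * (P (2 * n) / (P (nat (int n + j)) * P (nat (int n - j)))))
        \<longlonglongrightarrow> qsign q j * z powi j * (qpoch_inf q q / (qpoch_inf q q * qpoch_inf q q))"
      using P1[of j] P1[of "-j"] P2 qq_nz by (intro tendsto_intros) auto
    moreover have "eventually (\<lambda>n. qsign q j * z powi j *
        (P (2 * n) / (P (nat (int n + j)) * P (nat (int n - j)))) = f j n) sequentially"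
      using eventually_ge_at_top[of "nat \<bar>j\<bar>"] by eventually_elim (auto simp: f_def)
    ultimately show "(\<lambda>n. f j n) \<longlonglongrightarrow>
        qsign q j * z powi j * (qpoch_inf q q / (qpoch_inf q q * qpoch_inf q q))"
      by (rule Lim_transform_eventually)
  next
    have "norm (f j n) \<le> norm z powi j * norm q powi tri j * (K / (d * d))" for j n
    proof -
      have "norm (P (2 * n) / (P a * P b)) \<le> K / (d * d)" for a b
        unfolding norm_divide norm_mult using d K by (intro frac_le mult_mono mult_pos_pos) (auto intro: less_imp_le)
      moreover have "0 \<le> K / (d * d)" using d K by simp
      moreover have "norm (qsign q j * z powi j) = norm z powi j * norm q powi tri j"
        by (simp add: norm_mult norm_qsign norm_power_int)
      ultimately have "norm (qsign q j * z powi j * (P (2 * n) / (P a * P b)))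
          \<le> norm z powi j * norm q powi tri j * (K / (d * d))" for a b
        unfolding norm_mult[of "qsign q j * z powi j"] by (metis mult_left_mono norm_ge_zero)
      moreover have "0 \<le> norm z powi j * norm q powi tri j * (K / (d * d))"
        using \<open>0 \<le> K / (d * d)\<close> by (intro mult_nonneg_nonneg) auto
      ultimately show ?thesis
        by (simp add: f_def del: times_divide_eq_right times_divide_eq_left)
    qed
    thus "eventually (\<lambda>n. \<forall>j. norm (f j n) \<le> norm z powi j * norm q powi tri j * (K / (d * d))) sequentially"
      by simp
    show "(\<lambda>j. norm z powi j * norm q powi tri j * (K / (d * d))) summable_on UNIV"
      using q z by (intro summable_on_cmult_left summable_gaussian) auto
  qed auto
  also have "(\<lambda>n. \<Sum>\<^sub>\<infinity>j. f j n) = (\<lambda>n. (\<Prod>k<n. 1 - z * q ^ k) * (\<Prod>k<n. 1 - q / z * q ^ k))"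
  proof
    fix n
    have "(\<Sum>\<^sub>\<infinity>j. f j n) = (\<Sum>\<^sub>\<infinity>j\<in>{- int n..int n}. f j n)"
      by (rule infsum_cong_neutral) (auto simp: f_def)
    also have "\<dots> = (\<Sum>j\<in>{- int n..int n}. f j n)" by simp
    also have "\<dots> = (\<Prod>k<n. 1 - z * q ^ k) * (\<Prod>k<n. 1 - q / z * q ^ k)"
      unfolding finite_triple_product[OF q z] by (intro sum.cong) (auto simp: f_def P_def)
    finally show "(\<Sum>\<^sub>\<infinity>j. f j n) = (\<Prod>k<n. 1 - z * q ^ k) * (\<Prod>k<n. 1 - q / z * q ^ k)" .
  qed
  finally have "(\<lambda>n. (\<Prod>k<n. 1 - z * q ^ k) * (\<Prod>k<n. 1 - q / z * q ^ k)) \<longlonglongrightarrow>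
      (\<Sum>\<^sub>\<infinity>j. qsign q j * z powi j * (1 / qpoch_inf q q))"
    using qq_nz by simp
  moreover have "(\<lambda>n. (\<Prod>k<n. 1 - z * q ^ k) * (\<Prod>k<n. 1 - q / z * q ^ k)) \<longlonglongrightarrow> theta q z"
    unfolding theta_def by (intro tendsto_mult LIMSEQ_qpoch_inf q)
  ultimately have "theta q z = (\<Sum>\<^sub>\<infinity>j. qsign q j * z powi j * (1 / qpoch_inf q q))"
    using LIMSEQ_unique by blast
  also have "\<dots> = (\<Sum>\<^sub>\<infinity>j. qsign q j * z powi j) * (1 / qpoch_inf q q)"
    by (rule infsum_cmult_left')
  also have "(\<Sum>\<^sub>\<infinity>j. qsign q j * z powi j) = theta_q q (- z)"
    unfolding theta_q_def by (intro infsum_cong) (auto simp: qsign_def power_int_minus_left)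
  finally show ?thesis using qq_nz by simp
qed

lemma theta_q_quasi_periodic:
  assumes "q \<noteq> 0" "z \<noteq> 0"
  shows "z powi n * q powi tri n * theta_q q (z * q powi n) = theta_q q z"
proof -
  have "theta_q q z = (\<Sum>\<^sub>\<infinity>m. z powi (m + n) * q powi tri (m + n))"
    unfolding theta_q_def tri_def[symmetric]
    by (rule infsum_reindex_bij_witness[of _ "\<lambda>m. m + n" "\<lambda>m. m - n"]) auto
  also have "\<dots> = (\<Sum>\<^sub>\<infinity>m. z powi n * q powi tri n * ((z * q powi n) powi m * q powi tri m))"
  proof (intro infsum_cong)
    fix m
    have "q powi (m * n) = (q powi n) powi m"
      by (simp add: mult.commute flip: power_int_mult)
    thus "z powi (m + n) * q powi tri (m + n) =
        z powi n * q powi tri n * ((z * q powi n) powi m * q powi tri m)"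
      using assms by (simp add: tri_add power_int_add power_int_mult_distrib mult_ac)
  qed
  finally show ?thesis
    unfolding theta_q_def tri_def[symmetric] by (simp add: infsum_cmult_right')
qed

lemma theta_shift:
  assumes "norm q < 1" "q \<noteq> 0" "y \<noteq> 0"
  shows "theta q y = - y * theta q (q * y)"
proof -
  have "theta q y = (1 - y) * (qpoch_inf q (q * y) * qpoch_inf q (q / y))"
    using qpoch_inf_rec[OF assms(1), of y] by (simp add: theta_def mult_ac)
  also have "1 - y = - y * (1 - 1 / y)"
    using assms by (simp add: field_simps)
  also have "- y * (1 - 1 / y) * (qpoch_inf q (q * y) * qpoch_inf q (q / y)) = - y * theta q (q * y)"
    using qpoch_inf_rec[OF assms(1), of "1 / y"] assms by (simp add: theta_def mult_ac)
  finally show ?thesis .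
qed

section \<open>The Borel transform\<close>

text \<open>
  The meromorphic identity theorem gives equality off a sparse set. A nicely meromorphic function is
  determined everywhere by its values off such a set: it takes the value of its limit, or \<open>0\<close> at a pole.
\<close>

lemma nicely_meromorphic_eqI:
  assumes F: "F nicely_meromorphic_on UNIV" and G: "G nicely_meromorphic_on UNIV"
    and FH: "F has_fps_expansion H" and GH: "G has_fps_expansion H"
  shows "F = G"
proof
  fix z
  have "eventually (\<lambda>z. F z = G z) (nhds 0)"
    using FH GH unfolding has_fps_expansion_def by (auto elim: eventually_elim2)
  hence ev0: "eventually (\<lambda>z. F z - G z = 0) (at 0)"
    by (auto simp: eventually_at_filter elim: eventually_mono)
  have "(\<lambda>z. F z - G z) meromorphic_on UNIV"
    using F G by (intro meromorphic_intros) (auto simp: nicely_meromorphic_on_def)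
  hence "eventually (\<lambda>z. F z - G z = 0) (cosparse UNIV) \<or>
         eventually (\<lambda>z. F z - G z \<noteq> 0) (cosparse UNIV)"
    by (rule meromorphic_imp_constant_or_avoid) auto
  hence "eventually (\<lambda>z. F z - G z = 0) (cosparse UNIV)"
  proof (elim disjE)
    assume "eventually (\<lambda>z. F z - G z \<noteq> 0) (cosparse UNIV)"
    hence "eventually (\<lambda>z. F z - G z \<noteq> 0) (at 0)"
      by (simp add: eventually_cosparse_open_eq)
    with ev0 have "eventually (\<lambda>_. False) (at (0::complex))"
      by eventually_elim simp
    thus ?thesis by simp
  qed auto
  hence ev: "eventually (\<lambda>w. F w = G w) (at z)"
    by (simp add: eventually_cosparse_open_eq)
  hence pole: "is_pole F z \<longleftrightarrow> is_pole G z"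
    by (intro is_pole_cong) auto
  show "F z = G z"
  proof (cases "is_pole F z")
    case True
    thus ?thesis
      using pole is_pole_zero_at_nicely_mero[OF F] is_pole_zero_at_nicely_mero[OF G] by auto
  next
    case False
    hence "F \<midarrow>z\<rightarrow> F z" "G \<midarrow>z\<rightarrow> G z"
      using F G pole unfolding nicely_meromorphic_on_def by blast+
    moreover have "F \<midarrow>z\<rightarrow> F z \<longleftrightarrow> G \<midarrow>z\<rightarrow> F z"
      by (intro tendsto_cong ev)
    ultimately show ?thesis
      using LIM_unique by blast
  qed
qed

lemma analytic_qpoch_inf:
  assumes "norm q < 1"
  shows "(\<lambda>z. qpoch_inf q (c * z)) analytic_on A"
proof -
  have "(qpoch_inf q \<circ> (\<lambda>z. c * z)) holomorphic_on UNIV"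
    by (intro holomorphic_on_compose_gen[OF _ holomorphic_qpoch_inf[OF assms]] holomorphic_intros) auto
  thus ?thesis
    by (auto simp: o_def analytic_on_open intro: analytic_on_subset[of _ UNIV])
qed

text \<open>
  Euler's identity \<open>\<Sum>\<^sub>n z\<^sup>n / (q)\<^sub>n = 1 / (z)\<^sub>\<infinity>\<close>. The right-hand side \<open>g\<close> is analytic at \<open>0\<close> and satisfies
  \<open>(1 - z) g(z) = g(q z)\<close>; comparing coefficients gives \<open>(1 - q\<^bsup>n+1\<^esup>) g\<^bsub>n+1\<^esub> = g\<^sub>n\<close>.
\<close>

lemma has_fps_expansion_inverse_qpoch_inf:
  assumes "norm q < 1"
  shows "(\<lambda>z. inverse (qpoch_inf q z)) has_fps_expansion
           Abs_fps (\<lambda>n. inverse (qpoch q q (int n)))"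
proof -
  have "(\<lambda>z. inverse (qpoch_inf q z)) analytic_on {0}"
    using analytic_qpoch_inf[OF assms, of 1 "{0}"] by (intro analytic_on_inverse) auto
  then obtain G where G: "(\<lambda>z. inverse (qpoch_inf q z)) has_fps_expansion G"
    using analytic_at_imp_has_fps_expansion_0 by blast
  have "((\<lambda>z. inverse (qpoch_inf q z)) \<circ> (\<lambda>z. q * z)) has_fps_expansion (G oo (fps_const q * fps_X))"
    by (intro has_fps_expansion_compose G fps_expansion_intros) auto
  hence 1: "(\<lambda>z. inverse (qpoch_inf q (z * q))) has_fps_expansion (G oo (fps_const q * fps_X))"
    by (simp add: o_def mult.commute)
  have "(\<lambda>z. (1 - z) * inverse (qpoch_inf q z)) has_fps_expansion (1 - fps_X) * G"
    by (intro G fps_expansion_intros)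
  also have "?this \<longleftrightarrow> (\<lambda>z. inverse (qpoch_inf q (z * q))) has_fps_expansion (1 - fps_X) * G"
  proof (rule has_fps_expansion_cong)
    have "eventually (\<lambda>z::complex. z \<in> - {1}) (nhds 0)"
      by (intro eventually_nhds_in_open) auto
    thus "eventually (\<lambda>z. (1 - z) * inverse (qpoch_inf q z) = inverse (qpoch_inf q (z * q))) (nhds 0)"
      by eventually_elim (subst qpoch_inf_rec[OF assms], auto)
  qed auto
  finally have eq: "G oo (fps_const q * fps_X) = (1 - fps_X) * G"
    using fps_expansion_unique_complex[OF 1] by simp
  have "fps_nth G n = inverse (qpoch q q (int n))" for n
  proof (induction n)
    case 0
    have "qpoch_inf q q \<noteq> 0"
      using nome_power_neq_1[OF assms] by (auto simp: qpoch_inf_eq_0_iff[OF assms])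
    thus ?case
      using has_fps_expansion_imp_0_eq_fps_nth_0[OF G] by (simp add: qpoch_def)
  next
    case (Suc n)
    have "q ^ Suc n * fps_nth G (Suc n) = fps_nth (G oo (fps_const q * fps_X)) (Suc n)"
      by (rule fps_nth_compose_linear [symmetric])
    also have "\<dots> = fps_nth G (Suc n) - fps_nth G n"
      unfolding eq by (simp add: algebra_simps)
    finally have "q ^ Suc n * fps_nth G (Suc n) = fps_nth G (Suc n) - fps_nth G n" .
    hence "(1 - q ^ Suc n) * fps_nth G (Suc n) = inverse (qpoch q q (int n))"
      using Suc.IH by (simp add: algebra_simps)
    also have "\<dots> = (1 - q ^ Suc n) * inverse (qpoch q q (int (Suc n)))"
      using qpoch_inf_rec[OF assms, of "q ^ Suc n"]
      by (simp add: qpoch_def power_int_def nat_add_distrib mult_ac)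
    finally show ?case
      using nome_power_neq_1[OF assms, of n] by simp
  qed
  hence "G = Abs_fps (\<lambda>n. inverse (qpoch q q (int n)))"
    by (intro fps_ext) simp
  with G show ?thesis by simp
qed

lemma qborel_f1:
  assumes q: "norm q < 1" "q \<noteq> 0"
  shows "qborel q (f1_fps q y) \<xi> = inverse (qpoch_inf q (- y * \<xi>))"
proof -
  define F where "F = (\<lambda>\<xi>. inverse (qpoch_inf q (- y * \<xi>)))"
  have "qborel_fps q (f1_fps q y) =
        Abs_fps (\<lambda>n. inverse (qpoch q q (int n))) oo (fps_const (- y) * fps_X)"
  proof (rule fps_ext)
    fix n
    have [simp]: "qpoch q 0 k = 1" for k by (simp add: qpoch_def)
    have "inverse (qsign q (int n)) * q ^ (n * (n - 1) div 2) = (-1) ^ n"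
      using q(2) by (simp add: qsign_altdef tri_int field_simps flip: power_mult_distrib)
    thus "fps_nth (qborel_fps q (f1_fps q y)) n =
       fps_nth (Abs_fps (\<lambda>n. inverse (qpoch q q (int n))) oo (fps_const (- y) * fps_X)) n"
      unfolding qborel_fps_def f1_fps_def phi_fps_def fps_nth_compose_linear
      by (simp add: qpochs_def power_int_minus divide_inverse mult_ac power_minus[of y])
  qed
  moreover have "((\<lambda>z. inverse (qpoch_inf q z)) \<circ> (\<lambda>\<xi>. - y * \<xi>)) has_fps_expansion
      (Abs_fps (\<lambda>n. inverse (qpoch q q (int n))) oo (fps_const (- y) * fps_X))"
    by (intro has_fps_expansion_compose has_fps_expansion_inverse_qpoch_inf q fps_expansion_intros) auto
  ultimately have exp: "F has_fps_expansion qborel_fps q (f1_fps q y)"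
    by (simp add: F_def o_def)
  have nice: "F nicely_meromorphic_on UNIV"
    unfolding F_def
    by (intro nicely_meromorphic_on_inverse analytic_on_imp_nicely_meromorphic_on analytic_qpoch_inf q)
  have "qborel q (f1_fps q y) = F"
    unfolding qborel_def
    using nice exp nicely_meromorphic_eqI by (intro the_equality) blast+
  thus ?thesis by (simp add: F_def)
qed

section \<open>The regularised bilateral series\<close>

text \<open>
  For \<open>n \<ge> 0\<close> the numerators are bounded and the denominators tend to \<open>1\<close>. Each step from \<open>-m\<close> to
  \<open>-(m+1)\<close> multiplies the quotient by \<open>(q\<^bsup>m+1\<^esup> - c) / (q\<^bsup>m+1\<^esup> - w)\<close>, whose numerator is at most 2 in
  modulus and whose denominator stays away from \<open>0\<close>, as it is never zero and tends to \<open>-w\<close>.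
  The sum \<open>K\<^sup>n + K\<^bsup>-n\<^esup>\<close> stands for \<open>K\<^bsup>|n|\<^esup>\<close> so that the bound fits into theta series.
\<close>

lemma qpoch_inf_quotient_bound:
  assumes q: "norm q < 1" "q \<noteq> 0" and w: "w \<noteq> 0" "w \<notin> qZ q"
  obtains C K :: real where "C \<ge> 0" "K > 0"
    "\<And>c n. norm c \<le> 1 \<Longrightarrow>
       norm (qpoch_inf q (c * q powi n) / qpoch_inf q (w * q powi n)) \<le> C * (K powi n + K powi (-n))"
proof -
  note nz = qpoch_inf_nonzero[OF q w(2)]
  have q0: "(\<lambda>n. q ^ n) \<longlonglongrightarrow> 0"
    using q(1) by (rule LIMSEQ_power_zero)
  have "isCont (qpoch_inf q) 0"
    using holomorphic_on_imp_continuous_on[OF holomorphic_qpoch_inf[OF q(1)]]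
    by (simp add: continuous_on_eq_continuous_at)
  moreover have "(\<lambda>n. w * q ^ n) \<longlonglongrightarrow> 0"
    using tendsto_mult_right_zero[OF q0, of w] by simp
  ultimately have "(\<lambda>n. qpoch_inf q (w * q ^ n)) \<longlonglongrightarrow> qpoch_inf q 0"
    by (rule isCont_tendsto_compose)
  moreover have "qpoch_inf q (w * q ^ n) \<noteq> 0" for n
    using nz[of "int n"] by simp
  ultimately obtain d where d: "d > 0" "\<And>n. d \<le> norm (qpoch_inf q (w * q ^ n))"
    by (elim nonzero_convergent_bounded_below) auto
  have "(\<lambda>n. q ^ n - w) \<longlonglongrightarrow> 0 - w"
    by (intro tendsto_intros q0)
  moreover have "q ^ n - w \<noteq> 0" for n
    using w(2) by (auto simp: qZ_def image_iff dest: spec[of _ "int n"])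
  ultimately obtain e where e: "e > 0" "\<And>n. e \<le> norm (q ^ n - w)"
    using w(1) by (elim nonzero_convergent_bounded_below) auto
  define K where "K = max 1 (2 / e)"
  define C where "C = exp (1 / (1 - norm q)) / d"
  have K: "K \<ge> 1" "2 / e \<le> K" by (auto simp: K_def)
  have C: "C \<ge> 0" using d by (simp add: C_def)
  have pos: "norm (qpoch_inf q (c * q ^ n) / qpoch_inf q (w * q ^ n)) \<le> C" if c: "norm c \<le> 1" for c n
  proof -
    have "norm (c * q ^ n) \<le> 1"
      using c q(1) by (simp add: norm_mult norm_power mult_le_one power_le_one)
    hence "exp (norm (c * q ^ n) / (1 - norm q)) \<le> exp (1 / (1 - norm q))"
      using q(1) by (simp add: divide_right_mono)
    hence "norm (qpoch_inf q (c * q ^ n)) \<le> exp (1 / (1 - norm q))"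
      using norm_qpoch_inf_le[OF q(1), of "c * q ^ n"] by linarith
    thus ?thesis
      unfolding norm_divide C_def using d by (intro frac_le) auto
  qed
  have neg: "norm (qpoch_inf q (c * q powi (- int m)) / qpoch_inf q (w * q powi (- int m))) \<le> C * K ^ m"
    if c: "norm c \<le> 1" for c m
  proof (induction m)
    case 0
    show ?case using pos[OF c, of 0] by simp
  next
    case (Suc m)
    define R where "R = (\<lambda>m. qpoch_inf q (c * q powi (- int m)) / qpoch_inf q (w * q powi (- int m)))"
    have step: "qpoch_inf q (u * q powi (- int (Suc m))) =
        (q ^ Suc m - u) / q ^ Suc m * qpoch_inf q (u * q powi (- int m))" for u
    proof -
      have inv: "q powi (- int k) = inverse (q ^ k)" for k
        by (simp only: power_int_minus power_int_of_nat)
      have "u * q powi (- int (Suc m)) * q = u * q powi (- int m)"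
        using q(2) unfolding inv by (simp add: field_simps)
      moreover have "1 - u * q powi (- int (Suc m)) = (q ^ Suc m - u) / q ^ Suc m"
        using q(2) unfolding inv by (simp add: field_simps)
      ultimately show ?thesis
        using qpoch_inf_rec[OF q(1), of "u * q powi (- int (Suc m))"] by (simp only:)
    qed
    have "R (Suc m) = (q ^ Suc m - c) / (q ^ Suc m - w) * R m"
    proof -
      have "(a / p * u) / (b / p * v) = a / b * (u / v)" if "p \<noteq> 0" for a b u v p :: complex
        using that by (cases "b = 0 \<or> v = 0") (auto simp: field_simps)
      thus ?thesis
        unfolding R_def step using q(2) by simp
    qed
    also have "norm \<dots> \<le> K * (C * K ^ m)"
      unfolding norm_mult
    proof (rule mult_mono)
      have "norm (q ^ Suc m - c) \<le> norm q ^ Suc m + norm c"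
        by (metis norm_power norm_triangle_ineq4)
      also have "\<dots> \<le> 1 + 1"
        using c q(1) by (intro add_mono power_le_one) auto
      finally have "norm ((q ^ Suc m - c) / (q ^ Suc m - w)) \<le> 2 / e"
        unfolding norm_divide using e(1) e(2)[of "Suc m"] by (intro frac_le) auto
      with K show "norm ((q ^ Suc m - c) / (q ^ Suc m - w)) \<le> K" by linarith
      show "norm (R m) \<le> C * K ^ m"
        using Suc.IH by (simp add: R_def)
    qed (use K in auto)
    finally show ?case by (simp add: R_def mult_ac)
  qed
  show ?thesis
  proof (rule that[OF C, of K])
    show "K > 0" using K by simp
    fix c :: complex and n :: int
    assume c: "norm c \<le> 1"
    show "norm (qpoch_inf q (c * q powi n) / qpoch_inf q (w * q powi n)) \<le> C * (K powi n + K powi (-n))"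
    proof (cases "n \<ge> 0")
      case True
      then obtain m where n: "n = int m" by (metis nonneg_int_cases)
      have "1 \<le> K powi n + K powi (-n)"
        using K by (simp add: n add_increasing2 one_le_power)
      thus ?thesis
        using pos[OF c, of m] mult_left_mono[OF _ C, of 1 "K powi n + K powi (-n)"] by (simp add: n)
    next
      case False
      then obtain m where n: "n = - int m" by (metis int_cases2 nonneg_int_cases of_nat_0_le_iff)
      have "K ^ m \<le> K powi n + K powi (-n)"
        using K by (simp add: n)
      thus ?thesis
        using neg[OF c, of m] mult_left_mono[OF _ C, of "K ^ m" "K powi n + K powi (-n)"] by (simp add: n)
    qed
  qed
qed

text \<open>
  If \<open>(c)\<^sub>\<infinity> \<noteq> 0\<close>, this is \<open>(c)\<^sub>\<infinity> / (w)\<^sub>\<infinity>\<close> times the series \<open>\<^sub>1\<psi>\<^sub>2\<close> with upper parameter \<open>w\<close> and lower parameters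
  \<open>0, c\<close>. Dividing by \<open>(w)\<^sub>\<infinity>\<close> makes the index shift in \<open>bilateral_shift\<close> a plain reindexing.
\<close>

definition bilateral :: "complex \<Rightarrow> complex \<Rightarrow> complex \<Rightarrow> complex \<Rightarrow> complex" where
  "bilateral q w c z = (\<Sum>\<^sub>\<infinity>n::int. qsign q n * z powi n *
     (qpoch_inf q (c * q powi n) / qpoch_inf q (w * q powi n)))"

lemma psi12_reg_eq_bilateral: "psi12_reg q w c z = qpoch_inf q w * bilateral q w c z"
  unfolding psi12_reg_def bilateral_def
  by (simp add: qpoch_def mult_ac flip: infsum_cmult_right')

lemma psi_eq_bilateral: "psi q [w] [0, 0] z = qpoch_inf q w * bilateral q w 0 z"
  unfolding psi_def bilateral_def
  by (simp add: qpochs_def qpoch_def mult_ac flip: infsum_cmult_right')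

lemma tendsto_bilateral:
  assumes q: "norm q < 1" "q \<noteq> 0" and w: "w \<noteq> 0" "w \<notin> qZ q" and z: "z \<noteq> 0"
  shows "((\<lambda>c. bilateral q w c z) \<longlongrightarrow> bilateral q w 0 z) (at 0)"
proof -
  obtain C K where CK: "C \<ge> 0" "K > 0" "\<And>c n. norm c \<le> 1 \<Longrightarrow>
      norm (qpoch_inf q (c * q powi n) / qpoch_inf q (w * q powi n)) \<le> C * (K powi n + K powi (-n))"
    using qpoch_inf_quotient_bound[OF q w] by blast
  define M where "M n = norm q powi tri n * norm z powi n * (C * (K powi n + K powi (-n)))" for n
  show ?thesis
    unfolding bilateral_def
  proof (rule tendsto_infsum_dominated)
    fix n :: int
    have "((\<lambda>c. qpoch_inf q (q powi n * c)) \<longlongrightarrow> qpoch_inf q (q powi n * 0)) (at 0)"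
      using analytic_at_imp_isCont[OF analytic_qpoch_inf[OF q(1)]] by (rule isContD)
    thus "((\<lambda>c. qsign q n * z powi n * (qpoch_inf q (c * q powi n) / qpoch_inf q (w * q powi n))) \<longlongrightarrow>
      qsign q n * z powi n * (qpoch_inf q (0 * q powi n) / qpoch_inf q (w * q powi n))) (at 0)"
      using qpoch_inf_nonzero[OF q w(2)] by (intro tendsto_intros) (simp_all add: mult.commute)
  next
    have "eventually (\<lambda>c::complex. c \<in> ball 0 1) (at 0)"
      by (rule eventually_at_in_open') auto
    thus "eventually (\<lambda>c. \<forall>n. norm (qsign q n * z powi n *
        (qpoch_inf q (c * q powi n) / qpoch_inf q (w * q powi n))) \<le> M n) (at 0)"
    proof eventually_elim
      case (elim c)
      show ?case
      proof
        fix n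
        show "norm (qsign q n * z powi n *
            (qpoch_inf q (c * q powi n) / qpoch_inf q (w * q powi n))) \<le> M n"
          unfolding M_def norm_mult[of _ "_ / _"] norm_mult[of "qsign q n"] norm_qsign norm_power_int
          using CK(3)[of c n] elim by (intro mult_left_mono) auto
      qed
    qed
    \<comment> \<open>The majorant is a sum of two theta series, with arguments \<open>|z| K\<close> and \<open>|z| / K\<close>.\<close>
    have "(\<lambda>n. C * ((norm z * K) powi n * norm q powi tri n) + C * ((norm z / K) powi n * norm q powi tri n))
            summable_on UNIV"
      using q z CK by (intro summable_on_add summable_on_cmult_right summable_gaussian) auto
    also have "(\<lambda>n. C * ((norm z * K) powi n * norm q powi tri n) + C * ((norm z / K) powi n * norm q powi tri n)) = M"
      using CK(2) by (auto simp: M_def fun_eq_iff power_int_mult_distrib power_int_divide_distrib power_int_minus field_simps)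
    finally show "M summable_on UNIV" .
  qed auto
qed

lemma bilateral_shift:
  assumes "q \<noteq> 0" "z \<noteq> 0"
  shows "bilateral q (q * w) 0 (q * z) = - bilateral q w 0 z / z"
proof -
  have qs: "qsign q (-1) = - q" by (simp add: qsign_def)
  have "bilateral q (q * w) 0 (q * z) =
    (\<Sum>\<^sub>\<infinity>n. - 1 / z * (qsign q n * z powi n * (qpoch_inf q (0 * q powi n) / qpoch_inf q (w * q powi n))))"
    unfolding bilateral_def
  proof (rule infsum_reindex_bij_witness[of _ "\<lambda>n. n - 1" "\<lambda>n. n + 1"])
    fix n :: int
    have "q powi (n + 1) = q powi n * q" using assms by (simp add: power_int_add)
    moreover have "q powi (- 1 - n) = inverse (q * q powi n)"
      using assms by (simp add: power_int_diff power_int_minus field_simps)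
    ultimately have "qsign q n * (q * z) powi n = - 1 / z * (qsign q (n + 1) * z powi (n + 1))"
      using qsign_add[of q "n + 1" "-1"] assms
      by (simp add: qs power_int_add power_int_minus power_int_mult_distrib field_simps)
    thus "- 1 / z * (qsign q (n + 1) * z powi (n + 1) *
        (qpoch_inf q (0 * q powi (n + 1)) / qpoch_inf q (w * q powi (n + 1)))) =
      qsign q n * (q * z) powi n * (qpoch_inf q (0 * q powi n) / qpoch_inf q (q * w * q powi n))"
      using \<open>q powi (n + 1) = q powi n * q\<close> by (simp add: mult_ac)
  qed auto
  thus ?thesis
    unfolding infsum_cmult_right' bilateral_def by simp
qed

section \<open>The little and the generalized \<open>\<mu>\<close>-function\<close>

lemma little_mu_eq_bilateral:
  assumes "norm (nome \<tau>) < 1" "nome \<tau> \<noteq> 0" "x \<notin> qZ (nome \<tau>)"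
  shows "little_mu \<tau> x y = \<i> * qpow \<tau> (-1/8) /
           (qpoch_inf (nome \<tau>) (nome \<tau>) * theta (nome \<tau>) (nome \<tau> * y)) *
           bilateral (nome \<tau>) x 0 (1 / y)"
  using qpoch_inf_nonzero[OF assms, of 0]
  by (simp add: little_mu_def Let_def psi_eq_bilateral)

text \<open>
  The choice \<open>\<lambda> = - x / y\<close> makes the Borel transform hit \<open>1 / (x q\<^sup>n)\<^sub>\<infinity>\<close>, while the theta
  denominators see only \<open>- q\<^sup>n / y\<close>, so that quasi-periodicity reduces them all to one constant.
\<close>

lemma qlaplace_qborel_f1:
  assumes q: "norm q < 1" "q \<noteq> 0" and x: "x \<noteq> 0" and y: "y \<noteq> 0"
  shows "qlaplace q (qborel q (f1_fps q y)) x (- x / y) =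
           bilateral q x 0 (1 / y) / (qpoch_inf q q * theta q (q * y))"
proof -
  let ?D = "qpoch_inf q q * theta q (q * y)"
  have D: "?D = theta_q q (- 1 / y)"
    using theta_q_eq_triple_product[OF q, of "1 / y"] q(2) y by (simp add: theta_def mult_ac)
  have "qlaplace q (qborel q (f1_fps q y)) x (- x / y) =
        (\<Sum>\<^sub>\<infinity>n. 1 / ?D * (qsign q n * (1 / y) powi n *
           (qpoch_inf q (0 * q powi n) / qpoch_inf q (x * q powi n))))"
    unfolding qlaplace_def
  proof (intro infsum_cong)
    fix n :: int
    have per: "qsign q n * (1 / y) powi n * theta_q q (- 1 / y * q powi n) = ?D"
      using theta_q_quasi_periodic[OF q(2), of "- 1 / y" n] y
      unfolding D qsign_altdef by (simp add: power_int_mult_distrib[of "-1" "1 / y" n, simplified] mult_ac)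
    have "qsign q n * (1 / y) powi n \<noteq> 0"
      using q y by (simp add: qsign_altdef)
    hence "1 / theta_q q (- 1 / y * q powi n) = 1 / ?D * (qsign q n * (1 / y) powi n)"
      unfolding per[symmetric] by simp
    moreover have eqs: "- x / y * q powi n / x = - 1 / y * q powi n" "- y * (- x / y * q powi n) = x * q powi n"
      using x y by simp_all
    ultimately show "qborel q (f1_fps q y) (- x / y * q powi n) / theta_q q (- x / y * q powi n / x) =
        1 / ?D * (qsign q n * (1 / y) powi n *
           (qpoch_inf q (0 * q powi n) / qpoch_inf q (x * q powi n)))"
      unfolding qborel_f1[OF q] eqs by (simp add: divide_inverse mult_ac)
  qed
  also have "\<dots> = 1 / ?D * bilateral q x 0 (1 / y)"
    unfolding bilateral_def by (rule infsum_cmult_right')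
  finally show ?thesis by simp
qed

text \<open>
  If \<open>exp L = x y\<close>, the logarithm \<open>L + 2 \<pi> i \<tau>\<close> of \<open>q x y\<close> contributes \<open>(x y)\<^bsup>\<alpha>/2\<^esup> a\<^bsup>1/2\<^esup>\<close> to the
  generalized \<open>\<mu>\<close>-function, which is exactly what the normalisation divides out, whatever
  branch \<open>L\<close> is. The rest is a function of \<open>a\<close> alone, so the limit is one at \<open>a = 0\<close>.
\<close>

lemma tendsto_mu_hat:
  assumes q: "norm (nome \<tau>) < 1" "nome \<tau> \<noteq> 0" and w: "w \<noteq> 0" "w \<notin> qZ (nome \<tau>)" and v: "v \<noteq> 0"
  shows "((\<lambda>\<alpha>. exp (- (\<alpha> / 2) * L) * qpow \<tau> (- (\<alpha> / 2)) *
             mu_hat \<tau> (L + 2 * of_real pi * \<i> * \<tau>) w v \<alpha>)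
          \<longlongrightarrow> \<i> * qpow \<tau> (-1/8) / (qpoch_inf (nome \<tau>) (nome \<tau>) * theta (nome \<tau>) v) *
             bilateral (nome \<tau>) w 0 (nome \<tau> / v)) (a_to_0 \<tau>)"
proof -
  let ?q = "nome \<tau>"
  let ?c = "\<i> * qpow \<tau> (-1/8) / (qpoch_inf ?q ?q * theta ?q v)"
  have "exp (- (\<alpha> / 2) * L) * qpow \<tau> (- (\<alpha> / 2)) *
          mu_hat \<tau> (L + 2 * of_real pi * \<i> * \<tau>) w v \<alpha> =
        ?c * bilateral ?q w (qpow \<tau> \<alpha> * w) (?q / v)" for \<alpha>
  proof -
    have "exp (- (\<alpha> / 2) * L) * qpow \<tau> (- (\<alpha> / 2)) * exp (\<alpha> / 2 * (L + 2 * of_real pi * \<i> * \<tau>)) = 1"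
      unfolding qpow_def exp_add[symmetric] by (simp add: field_simps)
    hence "exp (- (\<alpha> / 2) * L) * qpow \<tau> (- (\<alpha> / 2)) *
          mu_hat \<tau> (L + 2 * of_real pi * \<i> * \<tau>) w v \<alpha> =
       \<i> * qpow \<tau> (-1/8) / (qpoch_inf ?q w * qpoch_inf ?q ?q * theta ?q v) *
         psi12_reg ?q w (qpow \<tau> \<alpha> * w) (?q / v)"
      unfolding mu_hat_def Let_def by (simp add: mult_ac)
    thus ?thesis
      using qpoch_inf_nonzero[OF q w(2), of 0] by (simp add: psi12_reg_eq_bilateral)
  qed
  moreover have "((\<lambda>\<alpha>. ?c * bilateral ?q w (qpow \<tau> \<alpha> * w) (?q / v))
      \<longlongrightarrow> ?c * bilateral ?q w 0 (?q / v)) (a_to_0 \<tau>)"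
  proof (intro tendsto_mult_left)
    have "filterlim (\<lambda>a. a * w) (at 0) (at 0)"
      using w(1) by (auto simp: filterlim_at eventually_at_filter intro!: tendsto_eq_intros)
    moreover have "filterlim (qpow \<tau>) (at 0) (a_to_0 \<tau>)"
      unfolding a_to_0_def by (rule filterlim_filtercomap)
    ultimately have "filterlim (\<lambda>\<alpha>. qpow \<tau> \<alpha> * w) (at 0) (a_to_0 \<tau>)"
      by (rule filterlim_compose)
    thus "((\<lambda>\<alpha>. bilateral ?q w (qpow \<tau> \<alpha> * w) (?q / v)) \<longlongrightarrow> bilateral ?q w 0 (?q / v)) (a_to_0 \<tau>)"
      using tendsto_bilateral[OF q w, of "?q / v"] q(2) v by (auto intro: filterlim_compose)
  qed
  ultimately show ?thesis by simp
qed

theorem theorem1: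
  fixes \<tau> x y L :: complex
  assumes "Im \<tau> > 0"
    and "x \<noteq> 0" and "y \<noteq> 0"
    and "x \<notin> qZ (nome \<tau>)" and "y \<notin> qZ (nome \<tau>)"
    and "exp L = x * y"
  shows "little_mu \<tau> x y =
           \<i> * qpow \<tau> (-1/8) *
             qlaplace (nome \<tau>) (qborel (nome \<tau>) (f1_fps (nome \<tau>) y)) x (- x / y)
    \<and> ((\<lambda>\<alpha>. exp (- (\<alpha> / 2) * L) * qpow \<tau> (- (\<alpha> / 2)) *
              mu_hat \<tau> (L + 2 * of_real pi * \<i> * \<tau>) (nome \<tau> * x) y \<alpha>)
          \<longlongrightarrow> little_mu \<tau> x y) (a_to_0 \<tau>)
    \<and> ((\<lambda>\<alpha>. exp (- (\<alpha> / 2) * L) * qpow \<tau> (- (\<alpha> / 2)) *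
              mu_hat \<tau> (L + 2 * of_real pi * \<i> * \<tau>) x (nome \<tau> * y) \<alpha>)
          \<longlongrightarrow> little_mu \<tau> x y) (a_to_0 \<tau>)"
proof -
  define q where "q = nome \<tau>"
  have q: "norm q < 1" "q \<noteq> 0"
    using assms(1) by (auto simp: q_def nome_def)
  note little_mu = little_mu_eq_bilateral[OF q[unfolded q_def] assms(4), of y, folded q_def]
  have 1: "little_mu \<tau> x y = \<i> * qpow \<tau> (-1/8) * qlaplace q (qborel q (f1_fps q y)) x (- x / y)"
    unfolding little_mu qlaplace_qborel_f1[OF q assms(2,3)] by simp
  have qx: "q * x \<notin> qZ q"
  proof
    assume "q * x \<in> qZ q"
    then obtain n where "q * x = q powi n" by (auto simp: qZ_def)
    hence "x = q powi (n - 1)" using q(2) by (simp add: power_int_diff field_simps)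
    with assms(4) show False by (auto simp: qZ_def q_def)
  qed
  have "bilateral q (q * x) 0 (q / y) = - y * bilateral q x 0 (1 / y)"
    using bilateral_shift[OF q(2), of "1 / y" x] assms(3) by simp
  hence "\<i> * qpow \<tau> (-1/8) / (qpoch_inf q q * theta q y) * bilateral q (q * x) 0 (q / y) = little_mu \<tau> x y"
    unfolding little_mu theta_shift[OF q assms(3)] using assms(3) by simp
  with tendsto_mu_hat[OF q[unfolded q_def], of "q * x" y L, folded q_def] qx q assms(2,3)
  have 2: "((\<lambda>\<alpha>. exp (- (\<alpha> / 2) * L) * qpow \<tau> (- (\<alpha> / 2)) *
              mu_hat \<tau> (L + 2 * of_real pi * \<i> * \<tau>) (q * x) y \<alpha>) \<longlongrightarrow> little_mu \<tau> x y) (a_to_0 \<tau>)"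
    by simp
  have "q / (q * y) = 1 / y" using q(2) by simp
  with tendsto_mu_hat[OF q[unfolded q_def], of x "q * y" L, folded q_def] q assms
  have 3: "((\<lambda>\<alpha>. exp (- (\<alpha> / 2) * L) * qpow \<tau> (- (\<alpha> / 2)) *
              mu_hat \<tau> (L + 2 * of_real pi * \<i> * \<tau>) x (q * y) \<alpha>) \<longlongrightarrow> little_mu \<tau> x y) (a_to_0 \<tau>)"
    unfolding little_mu by (simp add: q_def)
  from 1 2 3 show ?thesis by (simp add: q_def)
qed

end
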